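(* Let $n\ge 3$ be an odd integer, let $\phi$ be the $n$-dimensional Morris orientation, and let $\pi$ be any permutation of $[n]$. Then, from any start vertex $v\in\{0,1\}^n$, the simple principal pivoting algorithm with pivot rule $\textsc{Murty}_\pi$ finds the sink of $\phi$ after at most $2n^2-(5n-3)/2$ iterations.
   Context: Notation: $[n]=\{1,\dots,n\}$. For $v\in\{0,1\}^n$ and $i\in[n]$, $v\oplus i$ is $v$ with the $i$th entry flipped. The $n$-cube is the graph on $\{0,1\}^n$ with edges $\{v,v\oplus i\}$. An orientation $\phi$ of the $n$-cube directs each edge; write $v\to v\oplus i$ if the edge is directed from $v$ to $v\oplus i$. Put $\phi(v)_i=-$ if $v\to v\oplus i$ and $\phi(v)_i=+$ if $v\oplus i\to v$. A sink is a vertex with no outgoing edges. Morris orientation: let $n\ge 3$ be odd, let $M\in\mathbb{R}^{n\times n}$ have $M_{ii}=1$ for all $i$, $M_{i,i+1}=2$ for $i<n$, $M_{n,1}=2$, and all other entries $0$, and let $q=(-1,\dots,-1)^T$. For $v\in\{0,1\}^n$ let $A_{B(v)}$ be the matrix whose $i$th column is the $i$th column of $-M$ if $v_i=1$ and the $i$th column of the identity matrix if $v_i=0$ (it is invertible). The $n$-dimensional Morris orientation $\phi$ is given by $v\to v\oplus i$ iff $(A_{B(v)}^{-1}q)_i<0$. Equivalently (combinatorial description): if $v=(1,\dots,1)$, all signs $\phi(v)_i$ are $+$ (this is the unique global sink). Otherwise choose any $i$ with $v_i=0$ and feed the bits $v_{i-1},v_{i-2},\dots,v_1,v_n,v_{n-1},\dots,v_i$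 in this order to the two-state transducer starting in state $S$ with transitions: in state $S$, on reading $0$ output $-$ and stay in $S$, on reading $1$ output $+$ and go to $T$; in state $T$, on reading $0$ output $+$ and go to $S$, on reading $1$ output $-$ and go to $S$. The sign output upon reading $v_j$ is $\phi(v)_j$ (the result does not depend on the choice of $i$). Simple principal pivoting algorithm: start at a given vertex $v$; while the set $\mathcal{O}=\{j\in[n]: v\to v\oplus j\}$ is nonempty, choose $i\in\mathcal{O}$ by the pivot rule and replace $v$ by $v\oplus i$ (one iteration); return $v$ when $\mathcal{O}=\emptyset$. The rule $\textsc{Murty}_\pi$ chooses the index $\pi(j)$ with the smallest $j\in[n]$ such that $\pi(j)\in\mathcal{O}$. *)

theory Defs
  imports
    "Jordan_Normal_Form.Gauss_Jordan_Elimination"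
    "HOL-Combinatorics.Permutations"
    "HOL-Library.FuncSet"
begin

type_synonym vertex = "nat \<Rightarrow> nat"

text \<open>
  A 0/1-vector of length \<open>n\<close> is a function on the indices \<open>1, \<dots>, n\<close>; extensionality
  (the value \<open>undefined\<close> outside these indices) makes its representation unique.
\<close>

definition cube :: "nat \<Rightarrow> vertex set" where
  "cube n = {1..n} \<rightarrow>\<^sub>E {0, 1}"

definition flip :: "vertex \<Rightarrow> nat \<Rightarrow> vertex" where
  "flip v i = v(i := 1 - v i)"

text \<open>
  An orientation \<open>\<phi>\<close> of the cube is given by its set of arcs: \<open>(v, flip v i) \<in> \<phi>\<close> means that
  the edge between \<open>v\<close> and \<open>flip v i\<close> is directed from \<open>v\<close> to \<open>flip v i\<close>.
\<close>

definition out_indices :: "nat \<Rightarrow> (vertex \<times> vertex) set \<Rightarrow> vertex \<Rightarrow> nat set" where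
  "out_indices n \<phi> v = {j \<in> {1..n}. (v, flip v j) \<in> \<phi>}"

definition is_sink :: "nat \<Rightarrow> (vertex \<times> vertex) set \<Rightarrow> vertex \<Rightarrow> bool" where
  "is_sink n \<phi> v \<longleftrightarrow> v \<in> cube n \<and> out_indices n \<phi> v = {}"


text \<open>
  Matrices and vectors are indexed from 0 in the library, so the entry with mathematical
  indices \<open>i, j \<in> {1..n}\<close> sits at position \<open>(i - 1, j - 1)\<close>.
\<close>

definition morris_entry :: "nat \<Rightarrow> nat \<Rightarrow> nat \<Rightarrow> real" where
  "morris_entry n i j =
     (if i = j then 1
      else if i < n \<and> j = i + 1 then 2
      else if i = n \<and> j = 1 then 2
      else 0)"

definition morris_matrix :: "nat \<Rightarrow> real mat" where
  "morris_matrix n = mat n n (\<lambda>(r, c). morris_entry n (r + 1) (c + 1))"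

definition morris_q :: "nat \<Rightarrow> real vec" where
  "morris_q n = vec n (\<lambda>_. -1)"

definition basis_matrix :: "nat \<Rightarrow> real mat \<Rightarrow> vertex \<Rightarrow> real mat" where
  "basis_matrix n M v =
     mat_of_cols n (map (\<lambda>c. if v (c + 1) = 1 then col (- M) c else col (1\<^sub>m n) c) [0..<n])"

text \<open>
  For odd \<open>n \<ge> 3\<close> every basis matrix of the Morris matrix is invertible, so
  \<open>mat_inverse\<close> does not return \<open>None\<close> below.
\<close>

definition morris_orientation :: "nat \<Rightarrow> (vertex \<times> vertex) set" where
  "morris_orientation n =
     {(v, flip v i) | v i. v \<in> cube n \<and> i \<in> {1..n} \<and>
        (the (mat_inverse (basis_matrix n (morris_matrix n) v)) *\<^sub>v morris_q n) $ (i - 1) < 0}"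


text \<open>
  \<open>spp n \<phi> rule v t w\<close>: started at \<open>v\<close>, simple principal pivoting terminates after exactly
  \<open>t\<close> iterations and returns \<open>w\<close>. The pivot rule maps the nonempty set of outgoing
  indices to one of its members.
\<close>

inductive spp ::
  "nat \<Rightarrow> (vertex \<times> vertex) set \<Rightarrow> (nat set \<Rightarrow> nat) \<Rightarrow> vertex \<Rightarrow> nat \<Rightarrow> vertex \<Rightarrow> bool"
  for n :: nat and \<phi> :: "(vertex \<times> vertex) set" and rule :: "nat set \<Rightarrow> nat"
where
  spp_return: "out_indices n \<phi> v = {} \<Longrightarrow> spp n \<phi> rule v 0 v"
| spp_pivot: "out_indices n \<phi> v \<noteq> {} \<Longrightarrow>
    spp n \<phi> rule (flip v (rule (out_indices n \<phi> v))) t w \<Longrightarrow> spp n \<phi> rule v (Suc t) w"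

definition murty_rule :: "nat \<Rightarrow> (nat \<Rightarrow> nat) \<Rightarrow> nat set \<Rightarrow> nat" where
  "murty_rule n \<pi> Out = \<pi> (LEAST j. j \<in> {1..n} \<and> \<pi> j \<in> Out)"

end

theory Submission
  imports Defs "Jordan_Normal_Form.Determinant"
begin

text \<open>
  Solving \<open>A\<^bsub>B(v)\<^esub> z = q\<close> cyclically shows that the sign of \<open>z\<^sub>j\<close> is given by the two-state
  transducer: an index is outgoing iff its bit agrees with the state in which it is read
  (\<open>S\<close> agreeing with 0, \<open>T\<close> with 1). Unless \<open>v\<close> is all ones, some 0 is read in state \<open>S\<close>:
  otherwise the two states would alternate around a cycle of odd length.

  Let \<open>x\<close> be the index of a 0 in \<open>v\<close> to which \<open>\<pi>\<close> gives the lowest priority. The ones of lower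
  priority are never flipped, because some 0 is always outgoing. Cut the cycle at \<open>x\<close> and read
  positions \<open>0, \<dots>, N = n - 1\<close> with \<open>x\<close> last. The weight \<open>\<Phi>\<close>, in which an outgoing 0 at position
  \<open>i\<close> counts \<open>N - i\<close> and an outgoing 1 counts 1, drops with every pivot other than the one at
  \<open>x\<close>, whatever the pivot rule. So \<open>x\<close> is flipped after at most \<open>\<Phi>\<close> pivots, and this happens
  only when \<open>x\<close> is the only outgoing 0; afterwards there is at most one outgoing 0, and hence
  \<open>\<Phi> \<le> N + N / 2\<close> for every later choice of \<open>x\<close>. Since \<open>\<Phi> \<le> N (N + 1) / 2\<close> for the first
  \<open>x\<close> and there are at most \<open>N\<close> later ones, the number of pivots is at most
  \<open>N (N + 1) / 2 + 1 + N (3 N / 2 + 1) = 2 n\<^sup>2 - (5 n - 3) / 2\<close>.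
\<close>

section \<open>Cyclic indices, reading positions and flips of cube vertices\<close>

definition nxt :: "nat \<Rightarrow> nat \<Rightarrow> nat" where
  "nxt n j = (if j = n then 1 else Suc j)"

text \<open>
  The transducer reads indices in decreasing order, so position \<open>i\<close> after the cut at \<open>x\<close> is the
  index \<open>x - 1 - i\<close> modulo \<open>n\<close>.
\<close>

definition idx :: "nat \<Rightarrow> nat \<Rightarrow> nat \<Rightarrow> nat" where
  "idx n x i = (if Suc i < x then x - Suc i else x + n - Suc i)"

lemma nxt_in: "j \<in> {1..n} \<Longrightarrow> nxt n j \<in> {1..n}"
  by (auto simp: nxt_def)

lemma idx_in: "x \<in> {1..n} \<Longrightarrow> i < n \<Longrightarrow> idx n x i \<in> {1..n}"
  by (auto simp: idx_def)

lemma nxt_idx_0: "x \<in> {1..n} \<Longrightarrow> nxt n (idx n x 0) = x"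
  by (auto simp: idx_def nxt_def)

lemma nxt_idx_Suc: "x \<in> {1..n} \<Longrightarrow> Suc i < n \<Longrightarrow> nxt n (idx n x (Suc i)) = idx n x i"
  by (auto simp: idx_def nxt_def)

lemma idx_last: "x \<in> {1..n} \<Longrightarrow> idx n x (n - 1) = x"
  by (auto simp: idx_def)

lemma idx_inj: "x \<in> {1..n} \<Longrightarrow> inj_on (idx n x) {..<n}"
  by (auto simp: idx_def inj_on_def split: if_splits)

lemma idx_surj:
  assumes "x \<in> {1..n}" "j \<in> {1..n}"
  obtains i where "i < n" "j = idx n x i"
proof (cases "j < x")
  case True
  with assms show ?thesis by (intro that[of "x - j - 1"]) (auto simp: idx_def)
next
  case False
  with assms show ?thesis by (intro that[of "x + n - j - 1"]) (auto simp: idx_def)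
qed

lemma cube_values: "v \<in> cube n \<Longrightarrow> j \<in> {1..n} \<Longrightarrow> v j = 0 \<or> v j = 1"
  by (auto simp: cube_def PiE_def Pi_def)

lemma flip_in_cube: "v \<in> cube n \<Longrightarrow> j \<in> {1..n} \<Longrightarrow> flip v j \<in> cube n"
  by (auto simp: cube_def flip_def PiE_def Pi_def extensional_def)

lemma flip_inject:
  assumes "v \<in> cube n" "i \<in> {1..n}" "flip v i = flip v j"
  shows "i = j"
proof (rule ccontr)
  assume "i \<noteq> j"
  then have "flip v i i \<noteq> flip v j i"
    using cube_values[OF assms(1,2)] by (auto simp: flip_def)
  then show False using assms(3) by simp
qed

section \<open>Nonsingularity of the basis matrices\<close>

lemma sum_nxt: "n \<ge> 1 \<Longrightarrow> (\<Sum>j\<in>{1..n}. f (nxt n j)) = (\<Sum>j\<in>{1..n}. f j)"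
  by (rule sum.reindex_bij_witness[of _ "\<lambda>j. if j = 1 then n else j - 1" "nxt n"])
     (auto simp: nxt_def split: if_splits)

text \<open>A 0 at \<open>x\<close> decouples the equation of its predecessor, and vanishing then
  spreads backwards around the cycle. If all bits are 1, then
  \<open>\<bar>f j\<bar> = 2 * \<bar>f (nxt n j)\<bar>\<close>, and summing over the cycle gives a
  total equal to its own double.\<close>

lemma morris_kernel:
  fixes f :: "nat \<Rightarrow> real"
  assumes n: "n \<ge> 3" and v: "v \<in> cube n"
    and f: "\<And>j. j \<in> {1..n} \<Longrightarrow>
      (if v j = 1 then - f j else f j) = (if v (nxt n j) = 1 then 2 * f (nxt n j) else 0)"
    and j: "j \<in> {1..n}"
  shows "f j = 0"
proof (cases "\<exists>x\<in>{1..n}. v x = 0")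
  case True
  then obtain x where x: "x \<in> {1..n}" "v x = 0" by auto
  have "i < n \<Longrightarrow> f (idx n x i) = 0" for i
  proof (induction i)
    case 0
    then show ?case
      using f[OF idx_in[OF x(1) 0]] x nxt_idx_0[OF x(1)] by (auto split: if_splits)
  next
    case (Suc i)
    then show ?case
      using f[OF idx_in[OF x(1) Suc.prems]] nxt_idx_Suc[OF x(1) Suc.prems]
      by (auto split: if_splits)
  qed
  then show ?thesis using idx_surj[OF x(1) j] by metis
next
  case False
  then have one: "v i = 1" if "i \<in> {1..n}" for i
    using cube_values[OF v that] that by blast
  have abs: "\<bar>f i\<bar> = 2 * \<bar>f (nxt n i)\<bar>" if "i \<in> {1..n}" for i
    using f[OF that] one[OF that] one[OF nxt_in[OF that]] by simp
  have "(\<Sum>i\<in>{1..n}. \<bar>f i\<bar>) = (\<Sum>i\<in>{1..n}. 2 * \<bar>f (nxt n i)\<bar>)"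
    by (rule sum.cong[OF refl abs])
  also have "\<dots> = 2 * (\<Sum>i\<in>{1..n}. \<bar>f i\<bar>)"
    using sum_nxt[of n "\<lambda>i. \<bar>f i\<bar>"] n by (simp flip: sum_distrib_left)
  finally have "(\<Sum>i\<in>{1..n}. \<bar>f i\<bar>) = 0" by simp
  then show ?thesis using j by (simp add: sum_nonneg_eq_0_iff)
qed

lemma basis_matrix_carrier: "basis_matrix n M v \<in> carrier_mat n n"
  by (auto simp: basis_matrix_def)

text \<open>Row \<open>j\<close> is supported on the two distinct columns \<open>j\<close> and
  \<open>nxt n j\<close>.\<close>

lemma basis_matrix_mult:
  fixes z :: "real vec"
  assumes n: "n \<ge> 3" and z: "z \<in> carrier_vec n" and j: "j \<in> {1..n}"
  shows "(basis_matrix n (morris_matrix n) v *\<^sub>v z) $ (j - 1) =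
    (if v j = 1 then - z $ (j - 1) else z $ (j - 1)) -
    (if v (nxt n j) = 1 then 2 * z $ (nxt n j - 1) else 0)"
proof -
  let ?A = "basis_matrix n (morris_matrix n) v"
  let ?e = "\<lambda>c. ?A $$ (j - 1, c) * z $ c"
  have ent: "?A $$ (j - 1, c) =
      (if v (c + 1) = 1 then - morris_entry n j (c + 1) else if c = j - 1 then 1 else 0)"
    if "c < n" for c
    using that j by (auto simp: basis_matrix_def mat_of_cols_index morris_matrix_def)
  have zero: "?A $$ (j - 1, c) = 0" if "c < n" "c \<noteq> j - 1" "c \<noteq> nxt n j - 1" for c
    using ent[OF that(1)] that(2,3) j by (auto simp: morris_entry_def nxt_def)
  have ne: "nxt n j - 1 \<noteq> j - 1" using j n by (auto simp: nxt_def)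
  have diag: "?A $$ (j - 1, j - 1) = (if v j = 1 then -1 else 1)"
    using ent[of "j - 1"] j by (auto simp: morris_entry_def)
  have off: "?A $$ (j - 1, nxt n j - 1) = (if v (nxt n j) = 1 then -2 else 0)"
    using ent[of "nxt n j - 1"] j n ne nxt_in[OF j] by (auto simp: morris_entry_def nxt_def)
  have "(?A *\<^sub>v z) $ (j - 1) = (\<Sum>c\<in>{0..<n}. ?e c)"
    using j z basis_matrix_carrier[of n "morris_matrix n" v] by (auto simp: scalar_prod_def)
  also have "\<dots> = (\<Sum>c\<in>{j - 1, nxt n j - 1}. ?e c)"
    using j nxt_in[OF j] n
    by (intro sum.mono_neutral_right) (auto simp: zero[simplified])
  also have "\<dots> = ?e (j - 1) + ?e (nxt n j - 1)" using ne by simp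
  also have "\<dots> = (if v j = 1 then - z $ (j - 1) else z $ (j - 1)) -
    (if v (nxt n j) = 1 then 2 * z $ (nxt n j - 1) else 0)"
    by (simp add: diag off del: One_nat_def)
  finally show ?thesis .
qed

text \<open>Trades the inverse matrix for a cyclic recurrence. The trivial kernel makes the
  determinant nonzero, so \<open>mat_inverse\<close> does return an inverse.\<close>

lemma morris_solution:
  assumes n: "n \<ge> 3" and v: "v \<in> cube n"
  obtains z :: "nat \<Rightarrow> real" where
    "\<And>j. j \<in> {1..n} \<Longrightarrow> (if v j = 1 then - z j else z j) -
       (if v (nxt n j) = 1 then 2 * z (nxt n j) else 0) = -1"
    "out_indices n (morris_orientation n) v = {j \<in> {1..n}. z j < 0}"
proof -
  let ?A = "basis_matrix n (morris_matrix n) v"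
  have A: "?A \<in> carrier_mat n n" by (rule basis_matrix_carrier)
  have "det ?A \<noteq> 0"
  proof
    assume "det ?A = 0"
    then obtain w where w: "w \<in> carrier_vec n" "w \<noteq> 0\<^sub>v n" "?A *\<^sub>v w = 0\<^sub>v n"
      using det_0_iff_vec_prod_zero[OF A] by auto
    have "w $ (j - 1) = 0" if "j \<in> {1..n}" for j
    proof (rule morris_kernel[OF n v _ that, of "\<lambda>j. w $ (j - 1)"])
      fix j assume "j \<in> {1..n}"
      then show "(if v j = 1 then - w $ (j - 1) else w $ (j - 1)) =
          (if v (nxt n j) = 1 then 2 * w $ (nxt n j - 1) else 0)"
        using basis_matrix_mult[OF n w(1), of j v] w(3) by auto
    qed
    then have "w $ i = 0" if "i < n" for i
      using that by (metis Suc_leI atLeastAtMost_iff diff_Suc_1 le_add1 plus_1_eq_Suc)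
    then have "w = 0\<^sub>v n" using w(1) by (intro eq_vecI) auto
    then show False using w(2) by simp
  qed
  then have "?A \<in> Units (ring_mat TYPE(real) n ())"
    by (rule det_non_zero_imp_unit[OF A])
  then obtain B where B: "mat_inverse ?A = Some B"
    using mat_inverse(1)[OF A] by fastforce
  have AB: "?A * B = 1\<^sub>m n" "B \<in> carrier_mat n n"
    using mat_inverse(2)[OF A B] by auto
  define w where "w = B *\<^sub>v morris_q n"
  have q: "morris_q n \<in> carrier_vec n" by (simp add: morris_q_def)
  have w: "w \<in> carrier_vec n" unfolding w_def using AB(2) q by simp
  have Aw: "?A *\<^sub>v w = morris_q n"
    unfolding w_def using assoc_mult_mat_vec[OF A AB(2) q, symmetric] AB(1) q by simp
  show ?thesis
  proof (rule that[of "\<lambda>j. w $ (j - 1)"])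
    fix j assume j: "j \<in> {1..n}"
    then show "(if v j = 1 then - w $ (j - 1) else w $ (j - 1)) -
        (if v (nxt n j) = 1 then 2 * w $ (nxt n j - 1) else 0) = -1"
      using basis_matrix_mult[OF n w j, of v] Aw by (auto simp: morris_q_def)
  next
    have "(v, flip v j) \<in> morris_orientation n \<longleftrightarrow> w $ (j - 1) < 0" if j: "j \<in> {1..n}" for j
      unfolding morris_orientation_def using flip_inject[OF v j] v j B
      by (auto simp: w_def)
    then show "out_indices n (morris_orientation n) v = {j \<in> {1..n}. w $ (j - 1) < 0}"
      by (auto simp: out_indices_def)
  qed
qed

section \<open>The transducer description of the Morris orientation\<close>

abbreviation morris_out :: "nat \<Rightarrow> vertex \<Rightarrow> nat set" where
  "morris_out n v \<equiv> out_indices n (morris_orientation n) v"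

lemma morris_out_subset: "morris_out n v \<subseteq> {1..n}"
  by (auto simp: out_indices_def)

lemma morris_out_ones:
  assumes "n \<ge> 3" "v \<in> cube n" "\<And>j. j \<in> {1..n} \<Longrightarrow> v j = 1"
  shows "morris_out n v = {}"
proof -
  obtain z :: "nat \<Rightarrow> real" where z:
    "\<And>j. j \<in> {1..n} \<Longrightarrow> (if v j = 1 then - z j else z j) -
       (if v (nxt n j) = 1 then 2 * z (nxt n j) else 0) = -1"
    "morris_out n v = {j \<in> {1..n}. z j < 0}"
    using morris_solution[OF assms(1,2)] by blast
  \<comment> \<open>The constant 1/3 solves \<open>z j + 2 * z (nxt n j) = 1\<close>; the difference
    from it satisfies the homogeneous system.\<close>
  have "z j - 1 / 3 = 0" if "j \<in> {1..n}" for j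
    using assms(3) nxt_in z(1)
    by (intro morris_kernel[OF assms(1,2) _ that]) (fastforce simp: field_simps)
  then show ?thesis using z(2) by fastforce
qed

text \<open>True is the transducer state \<open>T\<close>, False is \<open>S\<close>.\<close>

definition reading_state :: "nat \<Rightarrow> vertex \<Rightarrow> nat \<Rightarrow> bool" where
  "reading_state n v j \<longleftrightarrow> (j \<in> morris_out n v \<longleftrightarrow> v j = 1)"

text \<open>The state at \<open>j\<close> is \<open>T\<close> iff \<open>z j\<close>, negated when
  \<open>v j = 1\<close>, is positive. The recurrence gives this quantity as
  \<open>2 * z (nxt n j) - 1\<close> or as \<open>-1\<close>, according to the next bit.\<close>

lemma reading_state_nxt:
  assumes n: "n \<ge> 3" and v: "v \<in> cube n" and x: "x \<in> {1..n}" "v x = 0" and j: "j \<in> {1..n}"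
  shows "reading_state n v j \<longleftrightarrow> v (nxt n j) = 1 \<and> \<not> reading_state n v (nxt n j)"
proof -
  obtain z :: "nat \<Rightarrow> real" where z:
    "\<And>j. j \<in> {1..n} \<Longrightarrow> (if v j = 1 then - z j else z j) -
       (if v (nxt n j) = 1 then 2 * z (nxt n j) else 0) = -1"
    "morris_out n v = {j \<in> {1..n}. z j < 0}"
    using morris_solution[OF n v] by blast
  \<comment> \<open>The bound 1 reproduces itself: if \<open>\<bar>a\<bar> \<ge> 1\<close>, then
    \<open>\<bar>2 * a - 1\<bar> \<ge> 1\<close>, and \<open>2 * a - 1\<close> has the sign of
    \<open>a\<close>.\<close>
  have "i < n \<Longrightarrow> \<bar>z (idx n x i)\<bar> \<ge> 1" for i
  proof (induction i)
    case 0
    then show ?case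
      using z(1)[OF idx_in[OF x(1) 0]] x nxt_idx_0[OF x(1)] by (auto split: if_splits)
  next
    case (Suc i)
    then show ?case
      using z(1)[OF idx_in[OF x(1) Suc.prems]] nxt_idx_Suc[OF x(1) Suc.prems]
      by (auto split: if_splits)
  qed
  then have ge1: "\<bar>z i\<bar> \<ge> 1" if "i \<in> {1..n}" for i
    using idx_surj[OF x(1) that] by metis
  show ?thesis
    using z(1)[OF j] ge1[OF j] ge1[OF nxt_in[OF j]] j nxt_in[OF j]
    unfolding reading_state_def z(2) by (auto split: if_splits)
qed


section \<open>Weights along abstract transducer runs\<close>

text \<open>Here \<open>u i\<close> is the bit and \<open>s i\<close> the state, so
  \<open>u i = s i\<close> means outgoing. The value \<open>N - i\<close> exceeds by one the bound
  \<open>N - Suc i\<close> on the increase that flipping an outgoing 0 can cause behind it.\<close>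

definition weight :: "nat \<Rightarrow> (nat \<Rightarrow> bool) \<Rightarrow> (nat \<Rightarrow> bool) \<Rightarrow> nat \<Rightarrow> nat" where
  "weight N u s i = (if u i = s i then (if u i then 1 else N - i) else 0)"

text \<open>The state at \<open>q\<close> is left free, so that runs over the same bits can be
  compared from different states.\<close>

definition state_run :: "nat \<Rightarrow> nat \<Rightarrow> (nat \<Rightarrow> bool) \<Rightarrow> (nat \<Rightarrow> bool) \<Rightarrow> bool" where
  "state_run q N u s \<longleftrightarrow> (\<forall>i. q \<le> i \<and> i < N \<longrightarrow> s (Suc i) = (u i \<and> \<not> s i))"

lemma state_run_mono: "state_run q N u s \<Longrightarrow> q \<le> r \<Longrightarrow> state_run r N u s"
  by (auto simp: state_run_def)

lemma state_run_agree:
  assumes "r \<le> i" "i \<le> N" "state_run r N u s" "state_run r N u' s'" "s r = s' r"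
    and "\<And>j. r \<le> j \<Longrightarrow> j < i \<Longrightarrow> u j = u' j"
  shows "s i = s' i"
  using assms by (induction i rule: dec_induct) (auto simp: state_run_def)

lemma sum_weight_agree:
  assumes "state_run r N u s" "state_run r N u s'" "s r = s' r"
  shows "(\<Sum>i\<in>{r..N}. weight N u s' i) = (\<Sum>i\<in>{r..N}. weight N u s i)"
  using state_run_agree[OF _ _ assms] by (intro sum.cong) (auto simp: weight_def)

text \<open>
  Over a stretch of ones the two runs stay complementary and alternate, so their weights differ
  by at most one; the first 0 resets both runs to the same state.
\<close>

lemma sum_weight_differ:
  assumes "q \<le> N" "\<not> u N" "state_run q N u s" "state_run q N u s'" "s q \<noteq> s' q"
  shows "(\<Sum>i\<in>{q..N}. weight N u s' i) \<le> (\<Sum>i\<in>{q..N}. weight N u s i) + (N - q)"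
  using assms
proof (induction q rule: inc_induct)
  case base
  then show ?case by (auto simp: weight_def)
next
  case (step q)
  have runs: "state_run (Suc q) N u s" "state_run (Suc q) N u s'"
    using step.prems state_run_mono by force+
  have next_states: "s (Suc q) = (u q \<and> \<not> s q)" "s' (Suc q) = (u q \<and> \<not> s' q)"
    using step.prems step.hyps by (auto simp: state_run_def)
  have split: "(\<Sum>i\<in>{q..N}. f i) = f q + (\<Sum>i\<in>{Suc q..N}. f i)" for f :: "nat \<Rightarrow> nat"
    using step.hyps by (simp add: sum.atLeast_Suc_atMost)
  show ?case
  proof (cases "u q")
    case True
    then have "(\<Sum>i\<in>{Suc q..N}. weight N u s' i) \<le>
        (\<Sum>i\<in>{Suc q..N}. weight N u s i) + (N - Suc q)"
      using step.prems runs next_states by (intro step.IH) auto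
    moreover have "weight N u s' q \<le> 1" using True by (simp add: weight_def)
    ultimately show ?thesis using step.hyps unfolding split by linarith
  next
    case False
    then have "(\<Sum>i\<in>{Suc q..N}. weight N u s' i) = (\<Sum>i\<in>{Suc q..N}. weight N u s i)"
      using runs next_states by (intro sum_weight_agree) auto
    \<comment> \<open>The allowance \<open>N - q\<close> pays for the first 0; behind it the runs
      coincide.\<close>
    moreover have "weight N u s' q \<le> N - q" using False by (simp add: weight_def)
    ultimately show ?thesis unfolding split by linarith
  qed
qed

text \<open>Before \<open>p\<close> nothing changes, and at \<open>p\<close> the weight falls to 0.
  An outgoing 1 is read in \<open>T\<close>, which leads to \<open>S\<close> for either bit, so the
  tail is unchanged. After an outgoing 0 the runs continue in opposite states, and the tail grows by
  less than \<open>N - p\<close>.\<close>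

lemma sum_weight_flip:
  assumes p: "p < N" "u p = s p" and uN: "\<not> u N"
    and run: "state_run 0 N u s" and run': "state_run 0 N u' s'" and init: "s 0 = s' 0"
    and u': "u' = u(p := \<not> u p)"
  shows "(\<Sum>i\<in>{0..N}. weight N u' s' i) < (\<Sum>i\<in>{0..N}. weight N u s i)"
proof -
  have split: "(\<Sum>i\<in>{0..N}. f i) = (\<Sum>i\<in>{0..<p}. f i) + f p + (\<Sum>i\<in>{Suc p..N}. f i)"
    for f :: "nat \<Rightarrow> nat"
  proof -
    have "{0..N} = {0..<Suc p} \<union> {Suc p..N}" using p by auto
    then have "(\<Sum>i\<in>{0..N}. f i) = (\<Sum>i\<in>{0..<Suc p}. f i) + (\<Sum>i\<in>{Suc p..N}. f i)"
      by (simp only:) (rule sum.union_disjoint; auto)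
    then show ?thesis by simp
  qed
  have agree: "s i = s' i" if "i \<le> p" for i
    using that p u' by (intro state_run_agree[OF _ _ run run' init]) auto
  have head: "(\<Sum>i\<in>{0..<p}. weight N u' s' i) = (\<Sum>i\<in>{0..<p}. weight N u s i)"
    using agree u' by (intro sum.cong) (auto simp: weight_def)
  \<comment> \<open>Behind \<open>p\<close> the bits coincide, so \<open>s'\<close> becomes a second
    run over \<open>u\<close>, as the comparison lemmas require.\<close>
  have tail: "(\<Sum>i\<in>{Suc p..N}. weight N u' s' i) = (\<Sum>i\<in>{Suc p..N}. weight N u s' i)"
    using u' by (intro sum.cong) (auto simp: weight_def)
  have runs: "state_run (Suc p) N u s" "state_run (Suc p) N u s'"
    using run run' u' by (auto simp: state_run_def)
  have next_states: "s (Suc p) = (u p \<and> \<not> s p)" "s' (Suc p) = (\<not> u p \<and> \<not> s p)"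
    using p run run' u' agree[of p] by (auto simp: state_run_def)
  have mid: "weight N u' s' p = 0" using u' p agree[of p] by (auto simp: weight_def)
  show ?thesis
  proof (cases "u p")
    case True
    then have "(\<Sum>i\<in>{Suc p..N}. weight N u s' i) = (\<Sum>i\<in>{Suc p..N}. weight N u s i)"
      using runs next_states p by (intro sum_weight_agree) auto
    moreover have "weight N u s p = 1" using True p by (simp add: weight_def)
    ultimately show ?thesis unfolding split head mid tail by linarith
  next
    case False
    then have "(\<Sum>i\<in>{Suc p..N}. weight N u s' i) \<le>
        (\<Sum>i\<in>{Suc p..N}. weight N u s i) + (N - Suc p)"
      using runs next_states p uN by (intro sum_weight_differ) auto
    moreover have "weight N u s p = N - p" using False p by (simp add: weight_def)
    ultimately show ?thesis unfolding split head mid tail using p by linarith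
  qed
qed

lemma sum_weight_le:
  assumes "\<not> u N"
  shows "2 * (\<Sum>i\<in>{0..N}. weight N u s i) \<le> N * (N + 1)"
proof -
  have "(\<Sum>i\<in>{0..N}. weight N u s i) \<le> (\<Sum>i\<in>{0..N}. N - i)"
  proof (rule sum_mono)
    fix i assume "i \<in> {0..N}"
    \<comment> \<open>An outgoing 1 weighs more than \<open>N - i\<close> only at \<open>N\<close>,
      where the bit is 0.\<close>
    then show "weight N u s i \<le> N - i"
      using assms by (cases "i = N") (auto simp: weight_def)
  qed
  also have "\<dots> = (\<Sum>i\<in>{0..N}. i)"
    by (rule sum.reindex_bij_witness[of _ "\<lambda>i. N - i" "\<lambda>i. N - i"]) auto
  finally show ?thesis using gauss_sum_nat[of N] by simp
qed

text \<open>
  The state \<open>T\<close> never occurs at two consecutive positions, so at most \<open>N / 2\<close> ones are outgoing.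
\<close>

lemma sum_weight_single_zero:
  assumes "even N" and uN: "\<not> u N" and run: "state_run 0 N u s" and init: "\<not> s 0"
    and single: "\<And>i j. i \<le> N \<Longrightarrow> j \<le> N \<Longrightarrow> \<not> u i \<Longrightarrow> \<not> s i \<Longrightarrow> \<not> u j \<Longrightarrow> \<not> s j \<Longrightarrow> i = j"
  shows "(\<Sum>i\<in>{0..N}. weight N u s i) \<le> 3 * (N div 2)"
proof -
  let ?Z = "{i \<in> {0..N}. \<not> u i \<and> \<not> s i}" and ?D = "{i \<in> {0..N}. u i \<and> s i}"
  have "(\<Sum>i\<in>{0..N}. weight N u s i) =
      (\<Sum>i\<in>{0..N}. (if \<not> u i \<and> \<not> s i then N - i else 0) + (if u i \<and> s i then 1 else 0))"
    by (rule sum.cong) (auto simp: weight_def)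
  also have "\<dots> = (\<Sum>i\<in>?Z. N - i) + card ?D"
    by (simp only: sum.distrib sum.inter_filter finite_atLeastAtMost card_eq_sum)
  finally have eq: "(\<Sum>i\<in>{0..N}. weight N u s i) = (\<Sum>i\<in>?Z. N - i) + card ?D" .
  have "(\<Sum>i\<in>?Z. N - i) \<le> N"
  proof (cases "?Z = {}")
    case False
    then obtain a where "a \<in> ?Z" by blast
    then have "?Z = {a}" using single by auto
    then show ?thesis by simp
  qed (simp only: sum.empty)
  \<comment> \<open>The map \<open>(i + 1) div 2\<close> pairs the positions
    \<open>2 * k - 1\<close> and \<open>2 * k\<close>, and each pair holds at most one outgoing 1.
    Position 0 is read in \<open>S\<close> and position \<open>N\<close> holds a 0, which leaves
    \<open>N div 2\<close> pairs.\<close>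
  moreover have "card ?D \<le> card {1..N div 2}"
  proof (rule card_inj_on_le[of "\<lambda>i. (i + 1) div 2"])
    have adj: "\<not> (i \<in> ?D \<and> Suc i \<in> ?D)" for i
      using run by (auto simp: state_run_def)
    show "inj_on (\<lambda>i. (i + 1) div 2) ?D"
    proof (rule inj_onI)
      fix i j assume ij: "i \<in> ?D" "j \<in> ?D" "(i + 1) div 2 = (j + 1) div 2"
      then have "i = j \<or> i = Suc j \<or> j = Suc i" by presburger
      then show "i = j" using adj ij by blast
    qed
    show "(\<lambda>i. (i + 1) div 2) ` ?D \<subseteq> {1..N div 2}"
    proof safe
      fix i assume i: "i \<in> {0..N}" "u i" "s i"
      then have "i \<noteq> 0" "i \<noteq> N" using init uN by metis+
      then show "(i + 1) div 2 \<in> {1..N div 2}" using i(1) \<open>even N\<close> by auto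
    qed
  qed simp
  ultimately show ?thesis unfolding eq using \<open>even N\<close> by auto
qed

section \<open>The potential of a vertex relative to a cut\<close>

definition morris_potential :: "nat \<Rightarrow> vertex \<Rightarrow> nat \<Rightarrow> nat" where
  "morris_potential n v x = (\<Sum>i\<in>{0..n - 1}.
     weight (n - 1) (\<lambda>i. v (idx n x i) = 1) (\<lambda>i. reading_state n v (idx n x i)) i)"

text \<open>The zero \<open>y\<close> supplies the transducer law, while the cut \<open>x\<close>
  may hold a 1; this allows a vertex and its flip at \<open>x\<close> to be read from the same
  cut.\<close>

lemma morris_state_run:
  assumes n: "n \<ge> 3" and v: "v \<in> cube n" and y: "y \<in> {1..n}" "v y = 0" and x: "x \<in> {1..n}"
  shows "state_run 0 (n - 1) (\<lambda>i. v (idx n x i) = 1) (\<lambda>i. reading_state n v (idx n x i))"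
  unfolding state_run_def
proof safe
  fix i assume "i < n - 1"
  then have i: "Suc i < n" by simp
  show "reading_state n v (idx n x (Suc i)) \<Longrightarrow> v (idx n x i) = 1"
    "reading_state n v (idx n x (Suc i)) \<Longrightarrow> reading_state n v (idx n x i) \<Longrightarrow> False"
    "v (idx n x i) = 1 \<Longrightarrow> \<not> reading_state n v (idx n x i) \<Longrightarrow>
      reading_state n v (idx n x (Suc i))"
    using reading_state_nxt[OF n v y idx_in[OF x i]] nxt_idx_Suc[OF x i] by auto
qed

lemma morris_state_init:
  assumes "n \<ge> 3" "v \<in> cube n" "x \<in> {1..n}" "v x = 0"
  shows "\<not> reading_state n v (idx n x 0)"
  using reading_state_nxt[OF assms idx_in[OF assms(3)]] nxt_idx_0[OF assms(3)] assms by simp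

lemma mem_morris_out: "j \<in> morris_out n v \<longleftrightarrow> (v j = 1) = reading_state n v j"
  by (auto simp: reading_state_def)

lemma morris_out_zero:
  assumes n: "n \<ge> 3" "odd n" and v: "v \<in> cube n" and x: "x \<in> {1..n}" "v x = 0"
  obtains j where "j \<in> morris_out n v" "v j = 0"
proof (rule ccontr)
  assume "\<not> thesis"
  then have none: "v j = 0 \<Longrightarrow> reading_state n v j" for j
    using that by (auto simp: mem_morris_out)
  note run = morris_state_run[OF n(1) v x x(1)]
  \<comment> \<open>If every 0 is read in \<open>T\<close>, then a position in state
    \<open>S\<close> holds a 1 and leads to \<open>T\<close>, while \<open>T\<close> always leads to
    \<open>S\<close>. As \<open>n - 1\<close> is even, the 0 at \<open>x\<close> would be read in
    \<open>S\<close>.\<close>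
  have "i < n \<Longrightarrow> reading_state n v (idx n x i) \<longleftrightarrow> odd i" for i
  proof (induction i)
    case 0
    then show ?case using morris_state_init[OF n(1) v x] by simp
  next
    case (Suc i)
    then show ?case
      using run none[of "idx n x i"] cube_values[OF v idx_in[OF x(1), of i]]
      by (auto simp: state_run_def)
  qed
  from this[of "n - 1"] show False
    using none[OF x(2)] idx_last[OF x(1)] n by auto
qed

lemma morris_potential_flip:
  assumes n: "n \<ge> 3" and v: "v \<in> cube n" and x: "x \<in> {1..n}" "v x = 0"
    and j: "j \<in> morris_out n v" "j \<noteq> x"
  shows "morris_potential n (flip v j) x < morris_potential n v x"
proof -
  have jn: "j \<in> {1..n}" using j(1) morris_out_subset by blast
  obtain p where p: "p < n" "j = idx n x p" using idx_surj[OF x(1) jn] .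
  have "p \<noteq> n - 1" using p(2) j(2) idx_last[OF x(1)] by auto
  then have pN: "p < n - 1" using p(1) by simp
  have v': "flip v j \<in> cube n" by (rule flip_in_cube[OF v jn])
  have x': "flip v j x = 0" using x j(2) by (simp add: flip_def)
  \<comment> \<open>Beyond position \<open>n - 1\<close>, \<open>idx\<close> repeats earlier
    indices; the default \<open>False\<close> there makes the two bit sequences differ at
    \<open>p\<close> alone.\<close>
  let ?u = "\<lambda>i. if i < n then v (idx n x i) = 1 else False"
  let ?u' = "\<lambda>i. if i < n then flip v j (idx n x i) = 1 else False"
  let ?s = "\<lambda>i. reading_state n v (idx n x i)"
  let ?s' = "\<lambda>i. reading_state n (flip v j) (idx n x i)"
  have "(\<Sum>i\<in>{0..n - 1}. weight (n - 1) ?u' ?s' i) < (\<Sum>i\<in>{0..n - 1}. weight (n - 1) ?u ?s i)"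
  proof (rule sum_weight_flip[OF pN])
    show "?u p = ?s p" using j p by (auto simp: mem_morris_out)
    show "\<not> ?u (n - 1)" using idx_last[OF x(1)] x n by simp
    show "state_run 0 (n - 1) ?u ?s" "state_run 0 (n - 1) ?u' ?s'"
      using morris_state_run[OF n v x x(1)] morris_state_run[OF n v' x(1) x' x(1)]
      by (auto simp: state_run_def)
    show "?s 0 = ?s' 0"
      using morris_state_init[OF n v x] morris_state_init[OF n v' x(1) x'] by simp
    show "?u' = ?u(p := \<not> ?u p)"
    proof
      fix i
      have "idx n x i = idx n x p \<longleftrightarrow> i = p" if "i < n"
        using idx_inj[OF x(1)] that p(1) by (auto simp: inj_on_def)
      then show "?u' i = (?u(p := \<not> ?u p)) i"
        using p cube_values[OF v jn] by (auto simp: flip_def)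
    qed
  qed
  moreover have "(\<Sum>i\<in>{0..n - 1}. weight (n - 1) ?u' ?s' i) = morris_potential n (flip v j) x"
    "(\<Sum>i\<in>{0..n - 1}. weight (n - 1) ?u ?s i) = morris_potential n v x"
    unfolding morris_potential_def using n by (auto intro!: sum.cong simp: weight_def)
  ultimately show ?thesis by simp
qed

text \<open>
  A 0 that is outgoing after the flip was read in the opposite state before it. But the first such
  0 makes both runs agree from there on, so there is no second one.
\<close>

lemma single_zero_after_flip:
  assumes n: "n \<ge> 3" and v: "v \<in> cube n" and x: "x \<in> {1..n}" "v x = 0"
    and only: "\<And>j. j \<in> morris_out n v \<Longrightarrow> v j = 0 \<Longrightarrow> j = x"
    and y: "y \<in> {1..n}" "flip v x y = 0"
    and j: "j \<in> morris_out n (flip v x)" "flip v x j = 0"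
    and k: "k \<in> morris_out n (flip v x)" "flip v x k = 0"
  shows "j = k"
proof -
  let ?v' = "flip v x"
  have v': "?v' \<in> cube n" by (rule flip_in_cube[OF v x(1)])
  let ?u = "\<lambda>i. v (idx n x i) = 1" and ?u' = "\<lambda>i. ?v' (idx n x i) = 1"
  let ?s = "\<lambda>i. reading_state n v (idx n x i)" and ?s' = "\<lambda>i. reading_state n ?v' (idx n x i)"
  have run: "state_run 0 (n - 1) ?u ?s" by (rule morris_state_run[OF n v x x(1)])
  have run': "state_run 0 (n - 1) ?u' ?s'" by (rule morris_state_run[OF n v' y x(1)])
  have no: False
    if ab: "a < b" "b < n" and a: "?v' (idx n x a) = 0"
      and b: "idx n x b \<in> morris_out n ?v'" "?v' (idx n x b) = 0" for a b
  proof -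
    have bx: "idx n x b \<noteq> x" using b(2) x by (auto simp: flip_def)
    then have "b \<noteq> n - 1" using idx_last[OF x(1)] by auto
    then have bN: "b < n - 1" using ab by simp
    \<comment> \<open>The flipped index \<open>x\<close> occupies the last position, so all earlier
      bits agree.\<close>
    have same: "?u i = ?u' i" if "i < n - 1" for i
    proof -
      have "idx n x i \<noteq> idx n x (n - 1)"
        using inj_on_eq_iff[OF idx_inj[OF x(1)], of i "n - 1"] that by simp
      then show ?thesis using idx_last[OF x(1)] by (auto simp: flip_def)
    qed
    have "\<not> ?u' a" using a by simp
    moreover have "\<not> ?u a" using same[of a] a ab bN by auto
    ultimately have "?s (Suc a) = ?s' (Suc a)"
      using run run' ab bN by (auto simp: state_run_def)
    moreover have "state_run (Suc a) (n - 1) ?u ?s" "state_run (Suc a) (n - 1) ?u' ?s'"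
      by (rule state_run_mono[OF run], simp) (rule state_run_mono[OF run'], simp)
    ultimately have "?s b = ?s' b"
      using state_run_agree[of "Suc a" b "n - 1" ?u ?s ?u' ?s'] ab bN same by simp
    moreover have "\<not> ?s' b" using b by (simp add: mem_morris_out)
    moreover have "v (idx n x b) = 0" using b(2) bx by (simp add: flip_def)
    ultimately have "idx n x b \<in> morris_out n v" by (simp add: mem_morris_out)
    then show False using only \<open>v (idx n x b) = 0\<close> bx by blast
  qed
  obtain a where a: "a < n" "j = idx n x a"
    using idx_surj[OF x(1)] j(1) morris_out_subset by blast
  obtain b where b: "b < n" "k = idx n x b"
    using idx_surj[OF x(1)] k(1) morris_out_subset by blast
  have "\<not> a < b" using no[of a b] a b j k by auto
  moreover have "\<not> b < a" using no[of b a] a b j k by auto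
  ultimately show ?thesis using a b by simp
qed

lemma morris_potential_le:
  assumes "n \<ge> 3" "x \<in> {1..n}" "v x = 0"
  shows "2 * morris_potential n v x \<le> (n - 1) * n"
  using sum_weight_le[of "\<lambda>i. v (idx n x i) = 1" "n - 1"] idx_last[OF assms(2)] assms
  by (simp add: morris_potential_def)

lemma morris_potential_single_zero:
  assumes n: "n \<ge> 3" "odd n" and v: "v \<in> cube n" and x: "x \<in> {1..n}" "v x = 0"
    and single: "\<And>j k. j \<in> morris_out n v \<Longrightarrow> v j = 0 \<Longrightarrow>
      k \<in> morris_out n v \<Longrightarrow> v k = 0 \<Longrightarrow> j = k"
  shows "morris_potential n v x \<le> 3 * ((n - 1) div 2)"
  unfolding morris_potential_def
proof (rule sum_weight_single_zero)
  show "even (n - 1)" using n by simp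
  show "v (idx n x (n - 1)) \<noteq> 1" using idx_last[OF x(1)] x by simp
  show "\<not> reading_state n v (idx n x 0)" by (rule morris_state_init[OF n(1) v x])
next
  fix i j
  assume ij: "i \<le> n - 1" "j \<le> n - 1"
    and z: "v (idx n x i) \<noteq> 1" "\<not> reading_state n v (idx n x i)"
      "v (idx n x j) \<noteq> 1" "\<not> reading_state n v (idx n x j)"
  have "i < n" "j < n" using ij n by auto
  then have "v (idx n x i) = 0" "v (idx n x j) = 0"
    using z cube_values[OF v idx_in[OF x(1)]] by blast+
  then have "idx n x i = idx n x j"
    using single z by (simp add: mem_morris_out)
  then show "i = j" using idx_inj[OF x(1)] ij n by (auto simp: inj_on_def)
qed (rule morris_state_run[OF n(1) v x x(1)])

section \<open>The phases of Murty's rule\<close>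

definition last_zero :: "nat \<Rightarrow> (nat \<Rightarrow> nat) \<Rightarrow> vertex \<Rightarrow> nat" where
  "last_zero n \<pi> v = Max {r \<in> {1..n}. v (\<pi> r) = 0}"

text \<open>The \<open>+ 1\<close> pays for the pivot at the current cut. Each smaller rank holds a
  reserve for one later phase: the single-zero bound plus one pivot at its cut.\<close>

definition murty_potential :: "nat \<Rightarrow> (nat \<Rightarrow> nat) \<Rightarrow> vertex \<Rightarrow> nat" where
  "murty_potential n \<pi> v =
     (if \<forall>j\<in>{1..n}. v j = 1 then 0
      else morris_potential n v (\<pi> (last_zero n \<pi> v)) + 1
        + (last_zero n \<pi> v - 1) * (3 * ((n - 1) div 2) + 1))"

lemma last_zero:
  assumes "v \<in> cube n" "\<pi> permutes {1..n}" "\<not> (\<forall>j\<in>{1..n}. v j = 1)"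
  shows "last_zero n \<pi> v \<in> {1..n}" "v (\<pi> (last_zero n \<pi> v)) = 0"
    "\<And>r. r \<in> {1..n} \<Longrightarrow> v (\<pi> r) = 0 \<Longrightarrow> r \<le> last_zero n \<pi> v"
proof -
  obtain j where j: "j \<in> {1..n}" "v j = 0"
    using assms(3) cube_values[OF assms(1)] by blast
  then obtain r where "r \<in> {1..n}" "\<pi> r = j"
    using permutes_image[OF assms(2)] by (metis imageE)
  then have "{r \<in> {1..n}. v (\<pi> r) = 0} \<noteq> {}" using j by blast
  then have "last_zero n \<pi> v \<in> {r \<in> {1..n}. v (\<pi> r) = 0}"
    unfolding last_zero_def by (intro Max_in) auto
  then show "last_zero n \<pi> v \<in> {1..n}" "v (\<pi> (last_zero n \<pi> v)) = 0" by auto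
  show "\<And>r. r \<in> {1..n} \<Longrightarrow> v (\<pi> r) = 0 \<Longrightarrow> r \<le> last_zero n \<pi> v"
    unfolding last_zero_def by (intro Max_ge) auto
qed

lemma last_zero_eqI:
  assumes "r \<in> {1..n}" "v (\<pi> r) = 0" "\<And>k. k \<in> {1..n} \<Longrightarrow> v (\<pi> k) = 0 \<Longrightarrow> k \<le> r"
  shows "last_zero n \<pi> v = r"
  unfolding last_zero_def using assms by (intro Max_eqI) auto

lemma murty_step:
  assumes n: "n \<ge> 3" "odd n" and \<pi>: "\<pi> permutes {1..n}" and v: "v \<in> cube n"
    and not_ones: "\<not> (\<forall>j\<in>{1..n}. v j = 1)"
  defines "v' \<equiv> flip v (murty_rule n \<pi> (morris_out n v))"
  shows "v' \<in> cube n" "murty_potential n \<pi> v' < murty_potential n \<pi> v"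
proof -
  define d where "d = last_zero n \<pi> v"
  define r where "r = (LEAST j. j \<in> {1..n} \<and> \<pi> j \<in> morris_out n v)"
  have v'_def2: "v' = flip v (\<pi> r)" by (simp add: v'_def murty_rule_def r_def)
  note d = last_zero[OF v \<pi> not_ones, folded d_def]
  have img: "\<pi> k \<in> {1..n}" if "k \<in> {1..n}" for k using permutes_in_image[OF \<pi>, of k] that by simp
  have inj: "\<pi> k = \<pi> l \<longleftrightarrow> k = l" for k l using permutes_inj[OF \<pi>] by (auto dest: injD)
  have x: "\<pi> d \<in> {1..n}" "v (\<pi> d) = 0" using d img by auto
  have rank: "\<exists>k\<in>{1..n}. \<pi> k = j" if "j \<in> {1..n}" for j
    using permutes_image[OF \<pi>] that by (metis imageE)
  have r_le: "r \<le> k" if "k \<in> {1..n}" "\<pi> k \<in> morris_out n v" for k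
    unfolding r_def using that by (intro Least_le) auto
  obtain j where j: "j \<in> morris_out n v" "v j = 0" using morris_out_zero[OF n v x] .
  then obtain k where k: "k \<in> {1..n}" "\<pi> k = j" using rank morris_out_subset by blast
  have r: "r \<in> {1..n}" "\<pi> r \<in> morris_out n v"
    using LeastI[of "\<lambda>j. j \<in> {1..n} \<and> \<pi> j \<in> morris_out n v" k] k j unfolding r_def by auto
  \<comment> \<open>Some 0 is outgoing, and its rank is at most \<open>d\<close>.\<close>
  have "r \<le> d" using r_le[of k] d(3)[of k] k j by simp
  show v': "v' \<in> cube n" unfolding v'_def2 using r img by (intro flip_in_cube[OF v]) auto
  show "murty_potential n \<pi> v' < murty_potential n \<pi> v"
  proof (cases "r = d")
    case False
    then have "\<pi> r \<noteq> \<pi> d" by (simp add: inj)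
    then have x': "v' (\<pi> d) = 0" using x by (simp add: v'_def2 flip_def)
    have "last_zero n \<pi> v' = d"
      using d x' \<open>r \<le> d\<close> by (intro last_zero_eqI) (auto simp: v'_def2 flip_def inj split: if_splits)
    moreover have "\<not> (\<forall>j\<in>{1..n}. v' j = 1)" using x x' by fastforce
    ultimately show ?thesis
      using morris_potential_flip[OF n(1) v x r(2) \<open>\<pi> r \<noteq> \<pi> d\<close>] not_ones
      by (simp add: murty_potential_def d_def v'_def2)
  next
    case True
    \<comment> \<open>An outgoing 0 has rank at least \<open>r = d\<close>, by the choice of
      \<open>r\<close>, and at most \<open>d\<close>, by the choice of \<open>d\<close>.\<close>
    have only: "i = \<pi> d" if i: "i \<in> morris_out n v" "v i = 0" for i
    proof -
      obtain l where l: "l \<in> {1..n}" "\<pi> l = i" using rank i morris_out_subset by blast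
      then have "l = d" using r_le[of l] d(3)[of l] i True by auto
      then show ?thesis using l by simp
    qed
    show ?thesis
    proof (cases "\<forall>j\<in>{1..n}. v' j = 1")
      case all: True
      then show ?thesis using not_ones by (simp add: murty_potential_def)
    next
      case not_all: False
      define d' where "d' = last_zero n \<pi> v'"
      note d' = last_zero[OF v' \<pi> not_all, folded d'_def]
      have v'_eq: "v' = flip v (\<pi> d)" by (simp add: v'_def2 True)
      have "d' \<noteq> d" using d'(2) x by (auto simp: v'_eq flip_def)
      moreover have "d' \<le> d"
        using d' d(3)[of d'] calculation by (auto simp: v'_eq flip_def inj)
      ultimately have "d' < d" by simp
      have y: "\<pi> d' \<in> {1..n}" using d' img by auto
      let ?m = "3 * ((n - 1) div 2)"
      have "morris_potential n v' (\<pi> d') \<le> ?m"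
        using single_zero_after_flip[OF n(1) v x only y] d'(2)
        by (intro morris_potential_single_zero[OF n v' y d'(2)]) (auto simp: v'_eq)
      \<comment> \<open>The new phase with its final pivot costs one reserve, giving
        \<open>d'\<close> reserves in all; since \<open>d' < d\<close>, the old potential contains
        at least that many.\<close>
      then have "murty_potential n \<pi> v' \<le> (?m + 1) + (d' - 1) * (?m + 1)"
        using not_all by (simp add: murty_potential_def d'_def)
      also have "\<dots> = d' * (?m + 1)"
        using d'(1) by (cases d') auto
      also have "\<dots> \<le> (d - 1) * (?m + 1)"
        using \<open>d' < d\<close> by (intro mult_right_mono) auto
      also have "\<dots> < murty_potential n \<pi> v"
        using not_ones by (simp add: murty_potential_def d_def)
      finally show ?thesis .
    qed
  qed
qed

lemma murty_terminates:
  assumes n: "n \<ge> 3" "odd n" and \<pi>: "\<pi> permutes {1..n}" and v: "v \<in> cube n"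
  shows "\<exists>t \<le> murty_potential n \<pi> v.
    spp n (morris_orientation n) (murty_rule n \<pi>) v t (\<lambda>j. if j \<in> {1..n} then 1 else undefined)"
  using v
proof (induction "murty_potential n \<pi> v" arbitrary: v rule: less_induct)
  case less
  show ?case
  proof (cases "\<forall>j\<in>{1..n}. v j = 1")
    case True
    then have "v = (\<lambda>j. if j \<in> {1..n} then 1 else undefined)"
      using less.prems by (auto simp: cube_def PiE_def extensional_def fun_eq_iff)
    moreover have "morris_out n v = {}" using True morris_out_ones[OF n(1) less.prems] by blast
    ultimately show ?thesis using spp_return by blast
  next
    case False
    let ?v' = "flip v (murty_rule n \<pi> (morris_out n v))"
    note step = murty_step[OF n \<pi> less.prems False]
    obtain x where "x \<in> {1..n}" "v x = 0" using False cube_values[OF less.prems] by blast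
    then have out: "morris_out n v \<noteq> {}" using morris_out_zero[OF n less.prems] by blast
    obtain t where "t \<le> murty_potential n \<pi> ?v'"
      "spp n (morris_orientation n) (murty_rule n \<pi>) ?v' t
        (\<lambda>j. if j \<in> {1..n} then 1 else undefined)"
      using less.hyps[OF step(2) step(1)] by blast
    then show ?thesis using spp_pivot[OF out] step(2) by (meson Suc_leI le_less_trans)
  qed
qed

lemma murty_potential_le:
  assumes n: "n \<ge> 3" "odd n" and \<pi>: "\<pi> permutes {1..n}" and v: "v \<in> cube n"
  shows "real (murty_potential n \<pi> v) \<le> 2 * real n ^ 2 - (5 * real n - 3) / 2"
proof -
  obtain m where m: "n = 2 * m + 1" using n(2) by (auto elim: oddE)
  \<comment> \<open>This is the claimed bound rewritten for \<open>n = 2 * m + 1\<close>, and equals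
    \<open>m * (2 * m + 1) + 1 + 2 * m * (3 * m + 1)\<close>.\<close>
  have "murty_potential n \<pi> v \<le> 8 * m\<^sup>2 + 3 * m + 1"
  proof (cases "\<forall>j\<in>{1..n}. v j = 1")
    case False
    note d = last_zero[OF v \<pi> False]
    have "\<pi> (last_zero n \<pi> v) \<in> {1..n}" using permutes_in_image[OF \<pi>] d(1) by simp
    then have "morris_potential n v (\<pi> (last_zero n \<pi> v)) \<le> m * (2 * m + 1)"
      using morris_potential_le[where v = v, OF n(1) _ d(2)] m by simp
    moreover have "(last_zero n \<pi> v - 1) * (3 * m + 1) \<le> (2 * m) * (3 * m + 1)"
      using d(1) m by (intro mult_right_mono) auto
    ultimately have "murty_potential n \<pi> v \<le> m * (2 * m + 1) + 1 + (2 * m) * (3 * m + 1)"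
      using False m by (simp add: murty_potential_def)
    then show ?thesis by (simp add: algebra_simps power2_eq_square)
  qed (simp add: murty_potential_def)
  then have "real (murty_potential n \<pi> v) \<le> real (8 * m\<^sup>2 + 3 * m + 1)"
    by (simp only: of_nat_le_iff)
  also have "\<dots> = 2 * real n ^ 2 - (5 * real n - 3) / 2"
    by (simp add: m field_simps power2_eq_square)
  finally show ?thesis .
qed

theorem theorem4p1:
  fixes n :: nat and \<pi> :: "nat \<Rightarrow> nat" and v :: vertex
  assumes "n \<ge> 3" and "odd n"
    and "\<pi> permutes {1..n}"
    and "v \<in> cube n"
  shows "\<exists>s t. {w. is_sink n (morris_orientation n) w} = {s} \<and>
           spp n (morris_orientation n) (murty_rule n \<pi>) v t s \<and>
           real t \<le> 2 * real n ^ 2 - (5 * real n - 3) / 2"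
proof -
  let ?s = "\<lambda>j. if j \<in> {1..n} then 1 else undefined"
  \<comment> \<open>Every other vertex has an outgoing 0. Outside \<open>{1..n}\<close> the sink
    takes the value \<open>undefined\<close> forced by extensionality.\<close>
  have "is_sink n (morris_orientation n) w \<longleftrightarrow> w = ?s" for w
  proof
    assume w: "is_sink n (morris_orientation n) w"
    then have "w \<in> cube n" "morris_out n w = {}" by (auto simp: is_sink_def)
    then have "\<forall>j\<in>{1..n}. w j = 1"
      using morris_out_zero[OF assms(1,2) \<open>w \<in> cube n\<close>] cube_values[OF \<open>w \<in> cube n\<close>] by blast
    then show "w = ?s"
      using \<open>w \<in> cube n\<close> by (auto simp: cube_def PiE_def extensional_def fun_eq_iff)
  next
    assume w: "w = ?s"
    then have "w \<in> cube n" by (auto simp: cube_def)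
    then show "is_sink n (morris_orientation n) w"
      using morris_out_ones[OF assms(1)] w by (simp add: is_sink_def)
  qed
  then have "{w. is_sink n (morris_orientation n) w} = {?s}" by blast
  moreover obtain t where "t \<le> murty_potential n \<pi> v"
    "spp n (morris_orientation n) (murty_rule n \<pi>) v t ?s"
    using murty_terminates[OF assms] by blast
  moreover have "real t \<le> 2 * real n ^ 2 - (5 * real n - 3) / 2"
    using murty_potential_le[OF assms] \<open>t \<le> murty_potential n \<pi> v\<close> by linarith
  ultimately show ?thesis by blast
qed

end
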